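(* Let $P,Q$ be integers such that there exists $S\in\mathbb{Z}$ with $P=2S$ and $Q=S^2$. Then the Lucas sequence of first kind $(U_n(P,Q))_{n\in\mathbb{N}}$ is $\infty$-log concave.
   Context: $\mathbb{N}=\{0,1,2,\dots\}$. For integers $P,Q$ with $P^2-4Q\geq 0$, the Lucas sequence of first kind $U_n=U_n(P,Q)$ is defined by $U_0=0$, $U_1=1$, $U_n=PU_{n-1}-QU_{n-2}$ for $n\geq 2$. Every real sequence $(a_n)_{n\in\mathbb{N}}$ is extended to indices in $\mathbb{Z}$ by the convention $a_n=0$ for $n<0$. The log-operator $\mathcal{L}$ sends a real sequence $(a_n)_{n\in\mathbb{N}}$ to the real sequence $(b_n)_{n\in\mathbb{N}}$ with $b_n=\mathcal{L}(a_n)=a_n^2-a_{n-1}a_{n+1}$ (in particular $b_0=a_0^2$). For an integer $i\geq 1$, $\mathcal{L}^i$ denotes $\mathcal{L}$ applied $i$ times. A real sequence is $\infty$-log concave if $\mathcal{L}^i(a_n)$ is a nonnegative sequence for every integer $i\geq 1$. *)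

theory Defs
  imports Complex_Main
begin

(* The recursion makes sense for all integers P, Q; the usual standing assumption
   P^2 - 4 * Q >= 0 only restricts the parameters and is not built in here. *)
fun lucas_U :: "int \<Rightarrow> int \<Rightarrow> nat \<Rightarrow> int" where
  "lucas_U P Q 0 = 0"
| "lucas_U P Q (Suc 0) = 1"
| "lucas_U P Q (Suc (Suc n)) = P * lucas_U P Q (Suc n) - Q * lucas_U P Q n"

definition ext_int :: "(nat \<Rightarrow> real) \<Rightarrow> int \<Rightarrow> real" where
  "ext_int a k = (if k < 0 then 0 else a (nat k))"

(* The index n - 1 is taken in the integers, so that the term for n = 0 is (a 0)^2;
   truncated subtraction on nat would give a different value there. *)
definition log_operator :: "(nat \<Rightarrow> real) \<Rightarrow> nat \<Rightarrow> real" where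
  "log_operator a n =
     (ext_int a (int n))\<^sup>2 - ext_int a (int n - 1) * ext_int a (int n + 1)"

definition infinitely_log_concave :: "(nat \<Rightarrow> real) \<Rightarrow> bool" where
  "infinitely_log_concave a \<longleftrightarrow> (\<forall>i\<ge>1. \<forall>n. 0 \<le> (log_operator ^^ i) a n)"

end

theory Submission
  imports Defs
begin

text \<open>Here \<open>U\<^sub>n = n S\<^bsup>n-1\<^esup>\<close>. Since \<open>n\<^sup>2 - (n-1)(n+1) = 1\<close>, one application of the
  log-operator leaves the geometric sequence \<open>S\<^bsup>2(n-1)\<^esup>\<close> for \<open>n \<ge> 1\<close>, preceded by \<open>0\<close>; a second
  one leaves the indicator of \<open>n = 1\<close>, which the operator fixes.\<close>

lemma log_operator_0: "log_operator a 0 = (a 0)\<^sup>2"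
  by (simp add: log_operator_def ext_int_def)

lemma log_operator_Suc: "log_operator a (Suc n) = (a (Suc n))\<^sup>2 - a n * a (Suc (Suc n))"
  by (simp add: log_operator_def ext_int_def nat_add_distrib)

text \<open>The characteristic polynomial \<open>X^2 - 2 S X + S^2\<close> has the double root
  \<open>S\<close>. Indexing by \<open>Suc n\<close> avoids the exponent -1 at index 0.\<close>

lemma lucas_U_double_root: "lucas_U (2 * S) (S\<^sup>2) (Suc n) = int (Suc n) * S ^ n"
proof (induction n rule: induct_nat_012)
  case (ge2 n)
  then show ?case
    by (simp add: algebra_simps power2_eq_square)
qed auto

lemma log_operator_lucas_U_double_root:
  "log_operator (\<lambda>n. real_of_int (lucas_U (2 * S) (S\<^sup>2) n)) =
     case_nat 0 (\<lambda>n. (real_of_int S ^ 2) ^ n)"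
proof
  fix n
  show "log_operator (\<lambda>n. real_of_int (lucas_U (2 * S) (S\<^sup>2) n)) n =
     case_nat 0 (\<lambda>n. (real_of_int S ^ 2) ^ n) n"
  proof (cases n)
    case 0
    then show ?thesis by (simp add: log_operator_0)
  next
    case (Suc m)
    then show ?thesis
      \<comment> \<open>The closed form covers successor indices only, so index 1, with left
        neighbour at index 0, is treated apart.\<close>
      by (cases m) (simp_all add: log_operator_Suc lucas_U_double_root del: lucas_U.simps(3),
          simp add: algebra_simps power2_eq_square power_mult_distrib)
  qed
qed

text \<open>Inside a geometric sequence each square equals the product of the two neighbours; at
  index 1 the left neighbour is 0, so \<open>1\<close> survives.\<close>

lemma log_operator_shifted_geometric:
  "log_operator (case_nat 0 (\<lambda>n. r ^ n)) = (\<lambda>n. of_bool (n = 1))"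
proof
  fix n
  show "log_operator (case_nat 0 (\<lambda>n. r ^ n)) n = of_bool (n = 1)"
  proof (cases n)
    case 0
    then show ?thesis by (simp add: log_operator_0)
  next
    case (Suc m)
    then show ?thesis
      by (cases m) (simp_all add: log_operator_Suc power2_eq_square algebra_simps)
  qed
qed

text \<open>Two indices at distance 2 are never both 1, so the product term vanishes, and 0 and 1
  are their own squares.\<close>

lemma log_operator_indicator_1:
  "log_operator (\<lambda>n. of_bool (n = 1)) = (\<lambda>n. of_bool (n = 1))"
proof
  show "log_operator (\<lambda>n. of_bool (n = 1)) n = of_bool (n = 1)" for n
    by (cases n) (simp_all add: log_operator_0 log_operator_Suc)
qed

theorem corollary10:
  fixes P Q :: int
  assumes "\<exists>S::int. P = 2 * S \<and> Q = S\<^sup>2"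
  shows "infinitely_log_concave (\<lambda>n. real_of_int (lucas_U P Q n))"
  unfolding infinitely_log_concave_def
proof (intro allI impI)
  fix i n :: nat
  assume "1 \<le> i"
  then obtain j where i: "i = Suc j"
    by (cases i) auto
  obtain S where PQ: "P = 2 * S" "Q = S\<^sup>2"
    using assms by blast
  define g :: "nat \<Rightarrow> real" where "g = case_nat 0 (\<lambda>n. (real_of_int S ^ 2) ^ n)"
  have iter: "(log_operator ^^ Suc k) g = (\<lambda>n. of_bool (n = 1))" for k
    by (induction k)
      (simp_all add: g_def log_operator_shifted_geometric log_operator_indicator_1[simplified])
  \<comment> \<open>The innermost of the \<open>Suc j\<close> applications is split off, since it is
    the one that turns the Lucas sequence into \<open>g\<close>.\<close>
  have "(log_operator ^^ i) (\<lambda>n. real_of_int (lucas_U P Q n)) = (log_operator ^^ j) g"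
    by (simp add: i PQ g_def funpow_Suc_right log_operator_lucas_U_double_root del: funpow.simps)
  moreover have "0 \<le> (log_operator ^^ j) g n"
  proof (cases j)
    case 0
    \<comment> \<open>The ratio is the square of \<open>S\<close>, so \<open>g\<close> is
      nonnegative even for negative \<open>S\<close>.\<close>
    then show ?thesis by (simp add: g_def split: nat.split)
  next
    case (Suc k)
    then show ?thesis by (simp add: iter del: funpow.simps)
  qed
  ultimately show "0 \<le> (log_operator ^^ i) (\<lambda>n. real_of_int (lucas_U P Q n)) n"
    by simp
qed

end
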